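(* Let $D=\{\delta_1,\ldots,\delta_N\}\subset(0,1)$ with $\delta_i\neq\delta_j$ for $i\neq j$, and let $\succeq$ be a weak order on $\ell_\infty$. The following conditions are equivalent. (i) The relation $\succeq$ satisfies D-monotonicity (a), Continuity, Convexity (parts (a) and (b)), and Invariance with respect to generation $0$'s origin. (ii) There exists a grounded, convex, lower semi-continuous, and nondegenerate function $c:\Delta(D)\to[0,\infty]$ such that for all $x,y\in\ell_\infty$, $$x\succeq y \iff \min_{\mu\in\Delta(D)}\left(\sum_{\delta\in D}\langle\delta,x\rangle\mu(\delta)+c(\mu)\right)\geq \min_{\mu\in\Delta(D)}\left(\sum_{\delta\in D}\langle\delta,y\rangle\mu(\delta)+c(\mu)\right).$$
   Context: $\mathbb{T}=\{0,1,2,\ldots\}$. $\ell_\infty$ is the space of bounded real sequences $x=(x_t)_{t\in\mathbb{T}}$ with the supremum norm $\|x\|_\infty=\sup_t|x_t|$. For $\delta\in(0,1)$, $\langle\delta,x\rangle=\sum_{t\in\mathbb{T}}\delta^t x_t$. A weak order is a complete and transitive binary relation; $\succ$ and $\sim$ are the asymmetric and symmetric parts of $\succeq$. Let $\ell_\infty^0=\{(z_0,z_1,\ldots)\in\ell_\infty: z_t=0\ \forall t\geq 1\}$. $\Delta(D)$ is the set of probability measures on the finite set $D$ (identified with the standard simplex in $\mathbb{R}^N$). A function $c:\Delta(D)\to[0,\infty]$ is grounded if $\inf_{\mu\in\Delta(D)}c(\mu)=0$, and nondegenerate if there are at least two distinct $\mu\in\Delta(D)$ with $c(\mu)<\infty$.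 Axioms: - D-monotonicity (a): for all $x,y\in\ell_\infty$, if $\langle\delta,x\rangle\geq\langle\delta,y\rangle$ for all $\delta\in D$, then $x\succeq y$. - Continuity: for every $x\in\ell_\infty$, the sets $\{z\in\ell_\infty: z\succeq x\}$ and $\{z\in\ell_\infty: x\succeq z\}$ are closed. - Convexity: (a) for all $x,y\in\ell_\infty$, if $x\sim y$, then $\alpha x+(1-\alpha)y\succeq x$ for every $\alpha\in[0,1]$; and (b) there exist $x',y'\in\ell_\infty$ with $x'\sim y'$ and $\alpha x'+(1-\alpha)y'\succ x'$ for some $\alpha\in(0,1)$. - Invariance with respect to generation $0$'s origin: for all $x,y\in\ell_\infty$ and all $z^0\in\ell_\infty^0$, $x\succeq y$ if and only if $x+z^0\succeq y+z^0$. *)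

theory Defs
  imports "HOL-Analysis.Analysis"
begin

text \<open>
  Since \<^typ>\<open>nat\<close> carries the discrete topology, the bounded continuous functions from
  \<^typ>\<open>nat\<close> to \<^typ>\<open>real\<close> are exactly the bounded real sequences, and the library's
  norm on them is the supremum norm.
\<close>

type_synonym linf = "(nat, real) bcontfun"

type_synonym preference = "linf \<Rightarrow> linf \<Rightarrow> bool"

definition linf0 :: "linf set" where
  "linf0 = {z. \<forall>t\<ge>1. apply_bcontfun z t = 0}"

definition discounted :: "real \<Rightarrow> linf \<Rightarrow> real" where
  "discounted \<delta> x = (\<Sum>t. \<delta> ^ t * apply_bcontfun x t)"

text \<open>In what follows, \<^term>\<open>R x y\<close> reads: x is weakly preferred to y.\<close>

definition weak_order :: "preference \<Rightarrow> bool" where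
  "weak_order R \<longleftrightarrow> (\<forall>x y. R x y \<or> R y x) \<and> transp R"

definition strict_part :: "preference \<Rightarrow> preference" where
  "strict_part R x y \<longleftrightarrow> R x y \<and> \<not> R y x"

definition indiff_part :: "preference \<Rightarrow> preference" where
  "indiff_part R x y \<longleftrightarrow> R x y \<and> R y x"

definition D_monotonicity_a :: "real set \<Rightarrow> preference \<Rightarrow> bool" where
  "D_monotonicity_a D R \<longleftrightarrow>
     (\<forall>x y. (\<forall>\<delta>\<in>D. discounted \<delta> x \<ge> discounted \<delta> y) \<longrightarrow> R x y)"

definition pref_continuity :: "preference \<Rightarrow> bool" where
  "pref_continuity R \<longleftrightarrow> (\<forall>x. closed {z. R z x} \<and> closed {z. R x z})"

definition pref_convexity_a :: "preference \<Rightarrow> bool" where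
  "pref_convexity_a R \<longleftrightarrow>
     (\<forall>x y. indiff_part R x y \<longrightarrow>
        (\<forall>\<alpha>\<in>{0..1}. R (\<alpha> *\<^sub>R x + (1 - \<alpha>) *\<^sub>R y) x))"

definition pref_convexity_b :: "preference \<Rightarrow> bool" where
  "pref_convexity_b R \<longleftrightarrow>
     (\<exists>x y. indiff_part R x y \<and>
        (\<exists>\<alpha>\<in>{0<..<1}. strict_part R (\<alpha> *\<^sub>R x + (1 - \<alpha>) *\<^sub>R y) x))"

definition origin0_invariance :: "preference \<Rightarrow> bool" where
  "origin0_invariance R \<longleftrightarrow> (\<forall>x y. \<forall>z\<in>linf0. R x y \<longleftrightarrow> R (x + z) (y + z))"

text \<open>
  For a set of N distinct discount factors, enumerated injectively by \<open>d :: 'n \<Rightarrow> real\<close> with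
  N the cardinality of \<open>'n\<close>, a probability measure \<open>\<mu>\<close> on \<^term>\<open>range d\<close> is identified
  with the vector whose component \<open>i\<close> is \<open>\<mu>(d i)\<close>.
\<close>

definition prob_simplex :: "(real ^ 'n::finite) set" where
  "prob_simplex = {\<mu>. (\<forall>i. 0 \<le> \<mu> $ i) \<and> (\<Sum>i\<in>UNIV. \<mu> $ i) = 1}"

text \<open>
  Cost functions are total on \<^typ>\<open>real ^ 'n\<close>, but only their values on
  \<^const>\<open>prob_simplex\<close> enter the notions below. At the endpoints of the convexity
  inequality, 0 times infinity is 0 in \<^typ>\<open>ennreal\<close>.
\<close>

definition grounded :: "(real ^ 'n::finite \<Rightarrow> ennreal) \<Rightarrow> bool" where
  "grounded c \<longleftrightarrow> (INF \<mu>\<in>prob_simplex. c \<mu>) = 0"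

definition nondegenerate :: "(real ^ 'n::finite \<Rightarrow> ennreal) \<Rightarrow> bool" where
  "nondegenerate c \<longleftrightarrow>
     (\<exists>\<mu>\<in>prob_simplex. \<exists>\<nu>\<in>prob_simplex. \<mu> \<noteq> \<nu> \<and> c \<mu> < \<infinity> \<and> c \<nu> < \<infinity>)"

definition convex_cost :: "(real ^ 'n::finite \<Rightarrow> ennreal) \<Rightarrow> bool" where
  "convex_cost c \<longleftrightarrow>
     (\<forall>\<mu>\<in>prob_simplex. \<forall>\<nu>\<in>prob_simplex. \<forall>\<alpha>\<in>{0..1}.
        c (\<alpha> *\<^sub>R \<mu> + (1 - \<alpha>) *\<^sub>R \<nu>) \<le> ennreal \<alpha> * c \<mu> + ennreal (1 - \<alpha>) * c \<nu>)"

definition lsc_cost :: "(real ^ 'n::finite \<Rightarrow> ennreal) \<Rightarrow> bool" where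
  "lsc_cost c \<longleftrightarrow>
     (\<forall>a. openin (top_of_set prob_simplex) {\<mu>\<in>prob_simplex. a < c \<mu>})"

definition penalized ::
    "('n::finite \<Rightarrow> real) \<Rightarrow> (real ^ 'n \<Rightarrow> ennreal) \<Rightarrow> linf \<Rightarrow> real ^ 'n \<Rightarrow> ereal" where
  "penalized d c x \<mu> =
     ereal (\<Sum>i\<in>UNIV. discounted (d i) x * \<mu> $ i) + enn2ereal (c \<mu>)"

text \<open>
  The criterion is a minimum, not merely an infimum: the first conjunct says that the infimum
  in the second one is attained for every x.
\<close>

definition variational_representation ::
    "('n::finite \<Rightarrow> real) \<Rightarrow> (real ^ 'n \<Rightarrow> ennreal) \<Rightarrow> preference \<Rightarrow> bool" where
  "variational_representation d c R \<longleftrightarrow>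
     (\<forall>x. \<exists>\<mu>. is_arg_min (penalized d c x) (\<lambda>\<mu>. \<mu> \<in> prob_simplex) \<mu>) \<and>
     (\<forall>x y. R x y \<longleftrightarrow>
        (INF \<mu>\<in>prob_simplex. penalized d c x \<mu>) \<ge> (INF \<mu>\<in>prob_simplex. penalized d c y \<mu>))"

end

theory Submission
  imports Defs "HOL-Computational_Algebra.Polynomial"
begin

text \<open>
  Discounting with the factors \<open>d\<close> maps bounded sequences onto \<open>real ^ 'n\<close> (polynomial
  interpolation at the distinct \<open>d i\<close>), and changing generation \<open>0\<close>'s payoff adds a constant
  vector. By D-monotonicity a preference depends only on this image, so under the axioms it has a
  certainty equivalent \<open>J\<close> on \<open>real ^ 'n\<close> which is monotone and commutes with constants;
  convexity makes it concave. Duality gives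
  \<open>J u = (min \<mu>. u \<bullet> \<mu> + c \<mu>)\<close> with \<open>c \<mu> = (sup u. J u - u \<bullet> \<mu>)\<close>.
  Strict convexity somewhere says exactly that \<open>J\<close> is not affine, i.e. that \<open>c\<close> is finite at
  more than one point.
\<close>

section \<open>Discounted sums\<close>

lemma summable_discounted:
  assumes "\<delta> \<in> {0<..<1::real}"
  shows "summable (\<lambda>t. \<delta> ^ t * apply_bcontfun x t)"
proof (rule summable_comparison_test')
  show "summable (\<lambda>t. \<delta> ^ t * norm x)"
    using assms by (intro summable_mult2 summable_geometric) auto
  show "norm (\<delta> ^ t * apply_bcontfun x t) \<le> \<delta> ^ t * norm x" if "t \<ge> 0" for t
    using assms norm_bounded[of x t] by (auto simp: abs_mult intro!: mult_left_mono)
qed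

lemma discounted_add:
  assumes "\<delta> \<in> {0<..<1}"
  shows "discounted \<delta> (x + y) = discounted \<delta> x + discounted \<delta> y"
  using suminf_add[OF summable_discounted[OF assms, of x] summable_discounted[OF assms, of y]]
  by (simp add: discounted_def plus_bcontfun.rep_eq distrib_left)

lemma discounted_scaleR:
  assumes "\<delta> \<in> {0<..<1}"
  shows "discounted \<delta> (a *\<^sub>R x) = a * discounted \<delta> x"
  using suminf_mult[OF summable_discounted[OF assms, of x], of a]
  by (simp add: discounted_def scaleR_bcontfun.rep_eq mult.left_commute)

lemma abs_discounted_le:
  assumes "\<delta> \<in> {0<..<1}"
  shows "\<bar>discounted \<delta> x\<bar> \<le> norm x * (1 / (1 - \<delta>))"
proof -
  have geom: "summable (\<lambda>t. \<delta> ^ t)" "(\<Sum>t. \<delta> ^ t) = 1 / (1 - \<delta>)"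
    using assms by (auto intro!: summable_geometric suminf_geometric)
  have bound: "\<bar>\<delta> ^ t * apply_bcontfun x t\<bar> \<le> \<delta> ^ t * norm x" for t
    using assms norm_bounded[of x t] by (auto simp: abs_mult intro!: mult_left_mono)
  have abs: "summable (\<lambda>t. \<bar>\<delta> ^ t * apply_bcontfun x t\<bar>)"
    by (rule summable_comparison_test'[OF summable_mult2[OF geom(1), of "norm x"], of 0])
       (use bound in simp)
  have "\<bar>discounted \<delta> x\<bar> \<le> (\<Sum>t. \<bar>\<delta> ^ t * apply_bcontfun x t\<bar>)"
    unfolding discounted_def by (rule summable_rabs[OF abs])
  also have "\<dots> \<le> (\<Sum>t. \<delta> ^ t * norm x)"
    by (rule suminf_le[OF bound abs summable_mult2[OF geom(1)]])
  also have "\<dots> = norm x * (1 / (1 - \<delta>))"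
    using suminf_mult2[OF geom(1), of "norm x"] geom(2) by simp
  finally show ?thesis .
qed

lemma bounded_linear_discounted:
  assumes "\<delta> \<in> {0<..<1}"
  shows "bounded_linear (discounted \<delta>)"
proof (rule bounded_linear_intro)
  show "norm (discounted \<delta> x) \<le> norm x * (1 / (1 - \<delta>))" for x
    using abs_discounted_le[OF assms] by simp
qed (simp_all add: assms discounted_add[OF assms] discounted_scaleR[OF assms] mult.commute)

section \<open>Streams that pay generation \<open>0\<close> only\<close>

definition unit0 :: linf where
  "unit0 = Bcontfun (\<lambda>t. if t = 0 then 1 else 0)"

lemma apply_unit0: "apply_bcontfun unit0 t = (if t = 0 then 1 else 0)"
  unfolding unit0_def
  by (subst Bcontfun_inverse)
     (auto simp: bcontfun_def intro!: finite_imp_bounded finite_subset[of _ "{0, 1}"])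

lemma unit0_in_linf0: "k *\<^sub>R unit0 \<in> linf0"
  by (simp add: linf0_def scaleR_bcontfun.rep_eq apply_unit0)

lemma linf0E:
  assumes "z \<in> linf0"
  obtains k where "z = k *\<^sub>R unit0"
proof
  show "z = apply_bcontfun z 0 *\<^sub>R unit0"
    using assms by (intro bcontfun_eqI) (auto simp: linf0_def scaleR_bcontfun.rep_eq apply_unit0)
qed

lemma discounted_unit0 [simp]: "discounted \<delta> unit0 = 1"
  unfolding discounted_def
  by (subst suminf_finite[where N = "{0}"]) (auto simp: apply_unit0)

text \<open>The witness is the coefficient sequence of \<open>p\<close>: it takes finitely many
  values, hence is bounded, and its discounted sum stops at the degree.\<close>

lemma discounted_poly:
  obtains x where "\<And>\<delta>. discounted \<delta> x = poly p \<delta>"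
proof -
  have "coeff p n \<in> coeff p ` {..degree p} \<union> {0}" for n
    by (cases "n \<le> degree p") (auto simp: coeff_eq_0)
  then have "range (coeff p) \<subseteq> coeff p ` {..degree p} \<union> {0}"
    by blast
  then have "finite (range (coeff p))"
    by (rule finite_subset) auto
  then have "coeff p \<in> bcontfun"
    by (auto simp: bcontfun_def intro!: finite_imp_bounded)
  then obtain x where x: "coeff p = apply_bcontfun x"
    by (rule bcontfunE)
  have "discounted \<delta> x = poly p \<delta>" for \<delta>
    unfolding discounted_def x[symmetric] poly_altdef
    by (subst suminf_finite[where N = "{..degree p}"]) (auto simp: coeff_eq_0 mult.commute not_le)
  then show ?thesis by (rule that)
qed

section \<open>Payoff vectors for finitely many distinct discount factors\<close>

locale discount_factors =
  fixes d :: "'n::finite \<Rightarrow> real"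
  assumes inj_d: "inj d" and d_in: "range d \<subseteq> {0<..<1}"
begin

definition payoffs :: "linf \<Rightarrow> real ^ 'n" where
  "payoffs x = (\<chi> i. discounted (d i) x)"

lemma payoffs_nth [simp]: "payoffs x $ i = discounted (d i) x"
  by (simp add: payoffs_def)

lemma bounded_linear_payoffs: "bounded_linear payoffs"
proof -
  have "bounded_linear (\<lambda>x. \<Sum>i\<in>UNIV. discounted (d i) x *\<^sub>R axis i (1 :: real))"
    by (intro bounded_linear_sum bounded_linear_compose[OF bounded_linear_scaleR_left]
      bounded_linear_discounted subsetD[OF d_in] rangeI)
  moreover have "payoffs = (\<lambda>x. \<Sum>i\<in>UNIV. discounted (d i) x *\<^sub>R axis i 1)"
    by (rule ext) (simp add: vec_eq_iff axis_def if_distrib cong: if_cong)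
  ultimately show ?thesis by simp
qed

lemmas payoffs_linear = linear_simps[OF bounded_linear_payoffs]

text \<open>Every discount factor gives generation \<open>0\<close> weight 1. This is what turns the
  origin invariance axiom into invariance under constant vectors.\<close>

lemma payoffs_unit0: "payoffs unit0 = 1"
  by (simp add: vec_eq_iff)

text \<open>Lagrange interpolation at the nodes \<open>d i\<close>, distinct by
  \<open>inj_d\<close>: the coefficients of the interpolating polynomial \<open>P v\<close> form a
  stream with payoffs \<open>v\<close>. The \<open>L i\<close> are the basis polynomials before
  normalization.\<close>

lemma payoffs_surj: "surj payoffs"
proof (rule surjI)
  define L where "L i = (\<Prod>j\<in>UNIV - {i}. [:- d j, 1:])" for i
  have L0: "poly (L i) (d j) = 0" if "i \<noteq> j" for i j
    using that by (auto simp: L_def poly_prod)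
  have L1: "poly (L i) (d i) \<noteq> 0" for i
    using inj_d by (auto simp: L_def poly_prod inj_eq)
  define P where "P v = (\<Sum>i\<in>UNIV. smult (v $ i / poly (L i) (d i)) (L i))" for v :: "real ^ 'n"
  have P: "poly (P v) (d j) = v $ j" for v j
  proof -
    have "poly (P v) (d j) = (\<Sum>i\<in>UNIV. if i = j then v $ j else 0)"
      unfolding P_def poly_sum by (rule sum.cong) (auto simp: L0 L1)
    then show ?thesis by simp
  qed
  show "payoffs (SOME x. \<forall>\<delta>. discounted \<delta> x = poly (P v) \<delta>) = v" for v
    by (rule someI2_ex) (use discounted_poly[of "P v"] in \<open>auto simp: vec_eq_iff P\<close>)
qed

lemma penalized_payoffs: "penalized d c x \<mu> = ereal (payoffs x \<bullet> \<mu>) + enn2ereal (c \<mu>)"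
  by (simp add: penalized_def inner_vec_def)

end

section \<open>Conjugates of concave monetary functionals\<close>

text \<open>\<open>ennreal\<close> replaces a real by its positive part, which is subadditive;
  equality can fail for summands of opposite sign.\<close>

lemma ennreal_plus_le: "ennreal (a + b) \<le> ennreal a + ennreal b"
proof -
  have "ennreal (a + b) \<le> ennreal (max 0 a + max 0 b)"
    by (intro ennreal_leI) auto
  also have "\<dots> = ennreal a + ennreal b"
    by (simp add: max_def ennreal_neg)
  finally show ?thesis .
qed

lemma one_inner_simplex: "\<mu> \<in> prob_simplex \<Longrightarrow> (1 :: real ^ 'n::finite) \<bullet> \<mu> = 1"
  by (simp add: prob_simplex_def inner_vec_def)

lemma inner_simplex_mono:
  fixes u v :: "real ^ 'n::finite"
  assumes "\<mu> \<in> prob_simplex" "\<And>i. v $ i \<le> u $ i"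
  shows "v \<bullet> \<mu> \<le> u \<bullet> \<mu>"
  using assms by (auto simp: prob_simplex_def inner_vec_def intro!: sum_mono mult_right_mono)

lemma norm_simplex_le: "\<mu> \<in> prob_simplex \<Longrightarrow> norm (\<mu> :: real ^ 'n::finite) \<le> 1"
  using norm_le_l1_cart[of \<mu>] by (simp add: prob_simplex_def)

lemma ereal_le_enn2ereal_ennreal: "ereal r \<le> enn2ereal (ennreal r)"
proof (cases "0 \<le> r")
  case False
  then have "ereal r \<le> 0"
    by simp
  then show ?thesis
    using enn2ereal_nonneg by (rule order.trans)
qed simp

lemma ereal_diff_le_imp_le_add:
  assumes "ereal (a - b) \<le> c"
  shows "ereal a \<le> ereal b + c"
proof -
  have "ereal b + ereal (a - b) \<le> ereal b + c"
    using assms by (rule add_left_mono)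
  then show ?thesis by simp
qed

lemma penalty_finite:
  assumes "c \<mu> < (\<infinity> :: ennreal)"
  shows "ereal a + enn2ereal (c \<mu>) = ereal (a + enn2real (c \<mu>))"
proof -
  have "c \<mu> = ennreal (enn2real (c \<mu>))"
    using assms by simp
  then have "enn2ereal (c \<mu>) = ereal (enn2real (c \<mu>))"
    by (metis enn2ereal_ennreal enn2real_nonneg)
  then show ?thesis by simp
qed

text \<open>Up to sign these are the normalized convex risk measures of mathematical
  finance.\<close>

locale monetary_functional =
  fixes J :: "real ^ 'n::finite \<Rightarrow> real"
  assumes normalized: "J 0 = 0"
    and mono: "(\<And>i. v $ i \<le> u $ i) \<Longrightarrow> J v \<le> J u"
    and trans: "J (u + k *\<^sub>R 1) = J u + k"
    and concave: "0 \<le> \<alpha> \<Longrightarrow> \<alpha> \<le> 1 \<Longrightarrow>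
      \<alpha> * J u + (1 - \<alpha>) * J v \<le> J (\<alpha> *\<^sub>R u + (1 - \<alpha>) *\<^sub>R v)"
begin

text \<open>The shift by \<open>u\<close> moves the base point to the origin: for
  \<open>r = J u\<close> the set omits 0 and can be separated from it.\<close>

lemma convex_upper_set: "convex {w. r < J (w + u)}"
proof (rule convexI)
  fix x y :: "real ^ 'n" and a b :: real
  assume *: "x \<in> {w. r < J (w + u)}" "y \<in> {w. r < J (w + u)}" "0 \<le> a" "0 \<le> b" "a + b = 1"
  then have b: "b = 1 - a" by simp
  have eq: "a *\<^sub>R (x + u) + (1 - a) *\<^sub>R (y + u) = a *\<^sub>R x + b *\<^sub>R y + u"
    by (simp add: b algebra_simps)
  have "r < a * J (x + u) + b * J (y + u)"
    using * convex_bound_lt[of "- J (x + u)" "- r" "- J (y + u)" a b] by simp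
  also have "\<dots> \<le> J (a *\<^sub>R x + b *\<^sub>R y + u)"
    using concave[of a "x + u" "y + u"] * unfolding eq b by simp
  finally show "a *\<^sub>R x + b *\<^sub>R y \<in> {w. r < J (w + u)}" by simp
qed

text \<open>Since \<open>J\<close> commutes with constants, the normal of a hyperplane separating \<open>u\<close> from the
  strict upper level set of \<open>J\<close> at \<open>u\<close> can be scaled to a supergradient.\<close>

lemma supergradient:
  obtains \<mu> where "\<mu> \<in> prob_simplex" "\<And>v. J v \<le> J u + (v - u) \<bullet> \<mu>"
proof -
  define K where "K = {w. J u < J (w + u)}"
  have "convex K"
    unfolding K_def by (rule convex_upper_set)
  moreover have "0 \<notin> K"
    by (simp add: K_def)
  ultimately obtain a where a: "a \<noteq> 0" "\<And>w. w \<in> K \<Longrightarrow> 0 \<le> a \<bullet> w"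
    using separating_hyperplane_set_0[of K] by auto
  have one: "a \<bullet> 1 = (\<Sum>i\<in>UNIV. a $ i)"
    by (simp add: inner_vec_def)
  \<comment> \<open>The constant \<open>J u - J v + \<epsilon>\<close> lifts \<open>v\<close> to the
    value \<open>J u + \<epsilon>\<close>, so the displacement from \<open>u\<close> lies in
    \<open>K\<close>. Dividing by the inner product of \<open>a\<close> and \<open>1\<close> and
    letting \<epsilon> tend to 0 will give the supergradient inequality.\<close>
  have le: "0 \<le> a \<bullet> (v - u) + (J u - J v + \<epsilon>) * (a \<bullet> 1)" if "\<epsilon> > 0" for v \<epsilon>
  proof -
    have "v - u + (J u - J v + \<epsilon>) *\<^sub>R 1 \<in> K"
      using that trans[of v "J u - J v + \<epsilon>"] by (simp add: K_def algebra_simps)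
    from a(2)[OF this] show ?thesis
      by (simp add: inner_add_right)
  qed
  have nonneg: "0 \<le> a $ i" for i
  proof (rule ccontr)
    assume neg: "\<not> 0 \<le> a $ i"
    \<comment> \<open>With this \<open>t\<close> the inner product of \<open>a\<close> and
      \<open>1 + axis i t\<close> is at most -1, although monotonicity and translation put that
      vector in \<open>K\<close>.\<close>
    define t where "t = (\<bar>a \<bullet> 1\<bar> + 1) / (- a $ i)"
    have t: "t > 0" "t * a $ i = - (\<bar>a \<bullet> 1\<bar> + 1)"
      using neg by (auto simp: t_def field_simps)
    have "J (u + 1 *\<^sub>R 1) \<le> J (u + 1 *\<^sub>R 1 + axis i t)"
      using t by (intro mono) (auto simp: axis_def)
    then have "1 + axis i t \<in> K"
      using trans[of u 1] by (simp add: K_def add_ac)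
    from a(2)[OF this] show False
      using t(2) by (simp add: inner_add_right inner_axis mult.commute)
  qed
  have pos: "0 < a \<bullet> 1"
  proof -
    obtain i where "a $ i \<noteq> 0"
      using a(1) by (auto simp: vec_eq_iff)
    then have "0 < (\<Sum>i\<in>UNIV. a $ i)"
      using nonneg by (intro sum_pos2[of _ i]) (auto simp: order.strict_iff_order)
    then show ?thesis by (simp add: one)
  qed
  define \<mu> where "\<mu> = (1 / (a \<bullet> 1)) *\<^sub>R a"
  show ?thesis
  proof
    show "\<mu> \<in> prob_simplex"
      using pos nonneg by (auto simp: \<mu>_def prob_simplex_def sum_divide_distrib[symmetric] one)
    show "J v \<le> J u + (v - u) \<bullet> \<mu>" for v
    proof (rule field_le_epsilon)
      fix \<epsilon> :: real assume "\<epsilon> > 0"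
      from le[OF this, of v] pos show "J v \<le> J u + (v - u) \<bullet> \<mu> + \<epsilon>"
        by (simp add: \<mu>_def field_simps inner_commute)
    qed
  qed
qed

section \<open>The conjugate cost and its duality with \<open>J\<close>\<close>

text \<open>This is the concave conjugate of \<open>J\<close> up to sign. The term for
  \<open>u = 0\<close> is 0 by \<open>normalized\<close>, so clipping the terms at 0 leaves the
  supremum unchanged.\<close>

definition conj_cost :: "real ^ 'n \<Rightarrow> ennreal" where
  "conj_cost \<mu> = (SUP u. ennreal (J u - u \<bullet> \<mu>))"

lemma conj_cost_ge: "ennreal (J u - u \<bullet> \<mu>) \<le> conj_cost \<mu>"
  unfolding conj_cost_def by (rule SUP_upper) simp

text \<open>Before clipping, the cost is a supremum of functions affine in \<mu>;
  \<open>ennreal_plus_le\<close> carries convexity through the clipping.\<close>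

lemma convex_conj_cost: "convex_cost conj_cost"
  unfolding convex_cost_def
proof (intro ballI)
  fix \<mu> \<nu> :: "real ^ 'n" and \<alpha> :: real
  assume \<alpha>: "\<alpha> \<in> {0..1}"
  show "conj_cost (\<alpha> *\<^sub>R \<mu> + (1 - \<alpha>) *\<^sub>R \<nu>)
    \<le> ennreal \<alpha> * conj_cost \<mu> + ennreal (1 - \<alpha>) * conj_cost \<nu>"
    unfolding conj_cost_def[of "\<alpha> *\<^sub>R \<mu> + (1 - \<alpha>) *\<^sub>R \<nu>"]
  proof (rule SUP_least)
    fix u
    have eq: "J u - u \<bullet> (\<alpha> *\<^sub>R \<mu> + (1 - \<alpha>) *\<^sub>R \<nu>) = \<alpha> * (J u - u \<bullet> \<mu>) + (1 - \<alpha>) * (J u - u \<bullet> \<nu>)"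
      by (simp add: inner_add_right algebra_simps)
    have "ennreal (\<alpha> * (J u - u \<bullet> \<mu>) + (1 - \<alpha>) * (J u - u \<bullet> \<nu>))
        \<le> ennreal (\<alpha> * (J u - u \<bullet> \<mu>)) + ennreal ((1 - \<alpha>) * (J u - u \<bullet> \<nu>))"
      by (rule ennreal_plus_le)
    also have "\<dots> = ennreal \<alpha> * ennreal (J u - u \<bullet> \<mu>) + ennreal (1 - \<alpha>) * ennreal (J u - u \<bullet> \<nu>)"
      using \<alpha> by (simp add: ennreal_mult')
    also have "\<dots> \<le> ennreal \<alpha> * conj_cost \<mu> + ennreal (1 - \<alpha>) * conj_cost \<nu>"
      by (intro add_mono mult_left_mono conj_cost_ge) auto
    finally show "ennreal (J u - u \<bullet> (\<alpha> *\<^sub>R \<mu> + (1 - \<alpha>) *\<^sub>R \<nu>))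
      \<le> ennreal \<alpha> * conj_cost \<mu> + ennreal (1 - \<alpha>) * conj_cost \<nu>"
      by (simp only: eq)
  qed
qed

text \<open>A strict upper level set of a supremum is the union of those of its members, here
  continuous functions of \<mu>.\<close>

lemma lsc_conj_cost: "lsc_cost conj_cost"
  unfolding lsc_cost_def
proof
  fix a :: ennreal
  have "{\<mu>\<in>prob_simplex. a < conj_cost \<mu>} = prob_simplex \<inter> (\<Union>u. {\<mu>. a < ennreal (J u - u \<bullet> \<mu>)})"
    by (auto simp: conj_cost_def less_SUP_iff)
  moreover have "open (\<Union>u. {\<mu>. a < ennreal (J u - u \<bullet> \<mu>)})"
    by (intro open_UN ballI open_Collect_less continuous_intros continuous_on_ennreal)
  ultimately show "openin (top_of_set prob_simplex) {\<mu>\<in>prob_simplex. a < conj_cost \<mu>}"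
    by (auto simp: openin_open)
qed

text \<open>At a supergradient of \<open>J\<close> at \<open>u\<close> the supremum is attained at
  \<open>u\<close>. The supergradient inequality at 0 yields the last conclusion, which ensures that
  \<open>ennreal\<close> clips nothing.\<close>

lemma conj_cost_dual:
  obtains \<mu> where "\<mu> \<in> prob_simplex" "conj_cost \<mu> = ennreal (J u - u \<bullet> \<mu>)" "u \<bullet> \<mu> \<le> J u"
proof -
  obtain \<mu> where \<mu>: "\<mu> \<in> prob_simplex" "\<And>v. J v \<le> J u + (v - u) \<bullet> \<mu>"
    using supergradient by blast
  have "conj_cost \<mu> \<le> ennreal (J u - u \<bullet> \<mu>)"
    unfolding conj_cost_def
    by (intro SUP_least ennreal_leI) (use \<mu>(2) in \<open>simp add: inner_diff_left algebra_simps\<close>)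
  moreover have "u \<bullet> \<mu> \<le> J u"
    using \<mu>(2)[of 0] by (simp add: normalized)
  ultimately show ?thesis
    by (intro that[OF \<mu>(1)] order.antisym[OF _ conj_cost_ge])
qed

lemma grounded_conj_cost: "grounded conj_cost"
proof -
  obtain \<mu> where "\<mu> \<in> prob_simplex" "conj_cost \<mu> = 0"
    using conj_cost_dual[of 0] by (auto simp: normalized)
  then have "(INF \<mu>\<in>prob_simplex. conj_cost \<mu>) \<le> 0"
    by (metis INF_lower)
  then show ?thesis
    by (simp add: grounded_def)
qed

text \<open>The Fenchel-Young inequality, in additive form so that it also covers infinite
  cost.\<close>

lemma penalty_ge: "ereal (J u) \<le> ereal (u \<bullet> \<mu>) + enn2ereal (conj_cost \<mu>)"
proof -
  have "ereal (J u - u \<bullet> \<mu>) \<le> enn2ereal (conj_cost \<mu>)"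
    using ereal_le_enn2ereal_ennreal less_eq_ennreal.rep_eq[THEN iffD1, OF conj_cost_ge]
    by (rule order.trans)
  then show ?thesis
    by (rule ereal_diff_le_imp_le_add)
qed

lemma penalty_attained:
  obtains \<mu> where "\<mu> \<in> prob_simplex" "ereal (u \<bullet> \<mu>) + enn2ereal (conj_cost \<mu>) = ereal (J u)"
proof -
  obtain \<mu> where "\<mu> \<in> prob_simplex" "conj_cost \<mu> = ennreal (J u - u \<bullet> \<mu>)" "u \<bullet> \<mu> \<le> J u"
    using conj_cost_dual by blast
  then show ?thesis
    by (intro that[of \<mu>]) auto
qed

lemma INF_penalty:
  "(INF \<mu>\<in>prob_simplex. ereal (u \<bullet> \<mu>) + enn2ereal (conj_cost \<mu>)) = ereal (J u)"
proof (rule antisym)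
  obtain \<mu> where \<mu>: "\<mu> \<in> prob_simplex" "ereal (u \<bullet> \<mu>) + enn2ereal (conj_cost \<mu>) = ereal (J u)"
    using penalty_attained by blast
  show "(INF \<mu>\<in>prob_simplex. ereal (u \<bullet> \<mu>) + enn2ereal (conj_cost \<mu>)) \<le> ereal (J u)"
    unfolding \<mu>(2)[symmetric] by (rule INF_lower[OF \<mu>(1)])
qed (rule INF_greatest, rule penalty_ge)

text \<open>Were the cost finite at a single \<mu>, then \<mu> would be dual to both
  \<open>u\<close> and \<open>v\<close>. One affine function would dominate \<open>J\<close> and
  agree with it at \<open>u\<close> and \<open>v\<close>, forcing \<open>J \<le> 0\<close> at their
  mixture.\<close>

lemma nondegenerate_conj_cost:
  assumes "J u = 0" "J v = 0" "0 < J (\<alpha> *\<^sub>R u + (1 - \<alpha>) *\<^sub>R v)" "\<alpha> \<in> {0<..<1}"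
  shows "nondegenerate conj_cost"
proof (rule ccontr)
  assume *: "\<not> nondegenerate conj_cost"
  define w where "w = \<alpha> *\<^sub>R u + (1 - \<alpha>) *\<^sub>R v"
  obtain \<mu> where \<mu>: "\<mu> \<in> prob_simplex" "conj_cost \<mu> = ennreal (J u - u \<bullet> \<mu>)" "u \<bullet> \<mu> \<le> J u"
    using conj_cost_dual by blast
  obtain \<nu> where \<nu>: "\<nu> \<in> prob_simplex" "conj_cost \<nu> = ennreal (J v - v \<bullet> \<nu>)" "v \<bullet> \<nu> \<le> J v"
    using conj_cost_dual by blast
  have "conj_cost \<mu> < \<infinity>" "conj_cost \<nu> < \<infinity>"
    by (simp_all add: \<mu>(2) \<nu>(2))
  with * \<mu>(1) \<nu>(1) have "\<mu> = \<nu>"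
    unfolding nondegenerate_def by blast
  have "ennreal (J w - w \<bullet> \<mu>) \<le> ennreal (J u - u \<bullet> \<mu>)"
    using conj_cost_ge[of w \<mu>] \<mu>(2) by simp
  then have 1: "J w - w \<bullet> \<mu> \<le> - (u \<bullet> \<mu>)"
    using \<mu>(3) assms(1) by (simp add: ennreal_le_iff)
  have "ennreal (J w - w \<bullet> \<mu>) \<le> ennreal (J v - v \<bullet> \<mu>)"
    using conj_cost_ge[of w \<nu>] \<nu>(2) by (simp add: \<open>\<mu> = \<nu>\<close>)
  then have 2: "J w - w \<bullet> \<mu> \<le> - (v \<bullet> \<mu>)"
    using \<nu>(3) assms(2) by (simp add: ennreal_le_iff \<open>\<mu> = \<nu>\<close>)
  have "J w - w \<bullet> \<mu> = \<alpha> * (J w - w \<bullet> \<mu>) + (1 - \<alpha>) * (J w - w \<bullet> \<mu>)"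
    by (simp add: algebra_simps)
  also have "\<dots> \<le> \<alpha> * (- (u \<bullet> \<mu>)) + (1 - \<alpha>) * (- (v \<bullet> \<mu>))"
    using 1 2 assms(4) by (intro add_mono mult_left_mono) auto
  also have "\<dots> = - (w \<bullet> \<mu>)"
    by (simp add: w_def inner_add_left algebra_simps)
  finally show False
    using assms(3) by (simp add: w_def)
qed

end

section \<open>From the axioms to the representation\<close>

locale rational_preference = discount_factors d for d :: "'n::finite \<Rightarrow> real" +
  fixes R :: preference
  assumes weak: "weak_order R"
    and D_mono: "D_monotonicity_a (range d) R"
    and cont: "pref_continuity R"
    and conv_a: "pref_convexity_a R"
    and conv_b: "pref_convexity_b R"
    and inv0: "origin0_invariance R"
begin

lemma R_mono: "(\<And>i. payoffs y $ i \<le> payoffs x $ i) \<Longrightarrow> R x y"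
  using D_mono by (auto simp: D_monotonicity_a_def)

lemma R_total: "R x y \<or> R y x"
  using weak by (simp add: weak_order_def)

lemma R_trans: "R x y \<Longrightarrow> R y z \<Longrightarrow> R x z"
  using weak by (auto simp: weak_order_def elim: transpE)

lemma R_shift: "R (x + k *\<^sub>R unit0) (y + k *\<^sub>R unit0) \<longleftrightarrow> R x y"
  using inv0 unit0_in_linf0 by (auto simp: origin0_invariance_def)

lemma payoffs_const: "payoffs (k *\<^sub>R unit0) $ i = k"
  by (simp add: payoffs_linear payoffs_unit0 del: payoffs_nth)

lemma payoffs_bound: "- norm (payoffs x) \<le> payoffs x $ i" "payoffs x $ i \<le> norm (payoffs x)"
  using component_le_norm_cart[of "payoffs x" i] by (auto simp del: payoffs_nth)

lemma R_lower: "k \<le> - norm (payoffs x) \<Longrightarrow> R x (k *\<^sub>R unit0)"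
  by (rule R_mono) (use payoffs_bound(1) order.trans in \<open>simp add: payoffs_const del: payoffs_nth; blast\<close>)

lemma R_upper: "norm (payoffs x) \<le> k \<Longrightarrow> R (k *\<^sub>R unit0) x"
  by (rule R_mono) (use payoffs_bound(2) order.trans in \<open>simp add: payoffs_const del: payoffs_nth; blast\<close>)

text \<open>Monotonicity gives only a weak preference for larger constants. If two distinct constants
  were indifferent, then by invariance so would be all of them, and \<open>R\<close> would be trivial.\<close>

lemma R_const_iff: "R (k *\<^sub>R unit0) (l *\<^sub>R unit0) \<longleftrightarrow> l \<le> k"
proof
  assume "l \<le> k"
  then show "R (k *\<^sub>R unit0) (l *\<^sub>R unit0)"
    by (intro R_mono) (simp add: payoffs_const del: payoffs_nth)
next
  assume R: "R (k *\<^sub>R unit0) (l *\<^sub>R unit0)"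
  show "l \<le> k"
  proof (rule ccontr)
    assume "\<not> l \<le> k"
    define r where "r = l - k"
    have "r > 0"
      using \<open>\<not> l \<le> k\<close> by (simp add: r_def)
    have step: "R (s *\<^sub>R unit0) ((s + r) *\<^sub>R unit0)" for s
    proof -
      have "k + (s - k) = s" "l + (s - k) = s + r"
        by (simp_all add: r_def)
      then show ?thesis
        using R_shift[of "k *\<^sub>R unit0" "s - k" "l *\<^sub>R unit0"] R
        unfolding scaleR_add_left[symmetric] by metis
    qed
    have chain: "R (s *\<^sub>R unit0) ((s + real n * r) *\<^sub>R unit0)" for s n
    proof (induction n)
      case 0
      then show ?case using R_total by auto
    next
      case (Suc n)
      have "s + real (Suc n) * r = s + real n * r + r"
        by (simp add: algebra_simps)
      then show ?case
        using R_trans[OF Suc.IH step] by metis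
    qed
    have "R x y" for x y
    proof -
      \<comment> \<open>So many steps of length \<open>r\<close> lead from a constant below
        \<open>x\<close> to a constant above \<open>y\<close>.\<close>
      obtain n where "norm (payoffs x) + norm (payoffs y) < real n * r"
        using reals_Archimedean3[OF \<open>r > 0\<close>] by blast
      then have "R ((- norm (payoffs x) + real n * r) *\<^sub>R unit0) y"
        by (intro R_upper) simp
      moreover have "R x ((- norm (payoffs x)) *\<^sub>R unit0)"
        by (rule R_lower) simp
      ultimately show ?thesis
        using chain R_trans by blast
    qed
    then show False
      using conv_b by (auto simp: pref_convexity_b_def strict_part_def)
  qed
qed

text \<open>The constants weakly below \<open>x\<close> and those weakly above it form closed
  nonempty sets covering the real line, which is connected, so they meet.\<close>

lemma ex_certainty_equivalent: "\<exists>k. indiff_part R x (k *\<^sub>R unit0)"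
proof -
  define A where "A = (\<lambda>k. k *\<^sub>R unit0) -` {z. R x z}"
  define B where "B = (\<lambda>k. k *\<^sub>R unit0) -` {z. R z x}"
  have "closed A" "closed B"
    unfolding A_def B_def
    by (intro closed_vimage continuous_intros; use cont in \<open>simp add: pref_continuity_def\<close>)+
  moreover have "UNIV \<subseteq> A \<union> B"
    using R_total by (auto simp: A_def B_def)
  moreover have "A \<noteq> {}" "B \<noteq> {}"
    using R_lower[OF order.refl, of x] R_upper[OF order.refl, of x]
    unfolding A_def B_def vimage_def by blast+
  ultimately have "A \<inter> B \<noteq> {}"
    using connected_closedD[OF connected_UNIV, of A B] by auto
  then show ?thesis
    by (auto simp: A_def B_def indiff_part_def)
qed

definition certainty_equivalent :: "linf \<Rightarrow> real" where
  "certainty_equivalent x = (SOME k. indiff_part R x (k *\<^sub>R unit0))"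

lemma certainty_equivalent: "indiff_part R x (certainty_equivalent x *\<^sub>R unit0)"
  unfolding certainty_equivalent_def by (rule someI_ex[OF ex_certainty_equivalent])

lemma R_iff: "R x y \<longleftrightarrow> certainty_equivalent y \<le> certainty_equivalent x"
  using certainty_equivalent[of x] certainty_equivalent[of y] R_trans R_const_iff
  unfolding indiff_part_def by meson

lemma certainty_equivalent_const [simp]: "certainty_equivalent (k *\<^sub>R unit0) = k"
  using certainty_equivalent[of "k *\<^sub>R unit0"] by (simp add: indiff_part_def R_const_iff)

lemma certainty_equivalent_shift: "certainty_equivalent (x + k *\<^sub>R unit0) = certainty_equivalent x + k"
proof -
  have "indiff_part R (x + k *\<^sub>R unit0) (certainty_equivalent x *\<^sub>R unit0 + k *\<^sub>R unit0)"
    using certainty_equivalent[of x] by (simp add: indiff_part_def R_shift)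
  then have "certainty_equivalent (x + k *\<^sub>R unit0)
      = certainty_equivalent ((certainty_equivalent x + k) *\<^sub>R unit0)"
    by (simp add: indiff_part_def R_iff scaleR_add_left del: certainty_equivalent_const)
  then show ?thesis
    by simp
qed

text \<open>Convexity speaks of indifferent streams only, so both streams are first shifted to
  certainty equivalent 0; the shift is then undone in the mixture.\<close>

lemma certainty_equivalent_concave:
  assumes "0 \<le> \<alpha>" "\<alpha> \<le> 1"
  shows "\<alpha> * certainty_equivalent x + (1 - \<alpha>) * certainty_equivalent y
    \<le> certainty_equivalent (\<alpha> *\<^sub>R x + (1 - \<alpha>) *\<^sub>R y)"
proof -
  let ?m = "\<alpha> * certainty_equivalent x + (1 - \<alpha>) * certainty_equivalent y"
  define x' where "x' = x + (- certainty_equivalent x) *\<^sub>R unit0"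
  define y' where "y' = y + (- certainty_equivalent y) *\<^sub>R unit0"
  have 0: "certainty_equivalent x' = 0" "certainty_equivalent y' = 0"
    by (simp_all only: x'_def y'_def certainty_equivalent_shift)
  then have "indiff_part R x' y'"
    by (simp add: indiff_part_def R_iff)
  then have "R (\<alpha> *\<^sub>R x' + (1 - \<alpha>) *\<^sub>R y') x'"
    using conv_a[unfolded pref_convexity_a_def, rule_format, of x' y' \<alpha>] assms by simp
  then have "0 \<le> certainty_equivalent (\<alpha> *\<^sub>R x' + (1 - \<alpha>) *\<^sub>R y')"
    by (simp add: R_iff 0)
  also have "\<alpha> *\<^sub>R x' + (1 - \<alpha>) *\<^sub>R y' = \<alpha> *\<^sub>R x + (1 - \<alpha>) *\<^sub>R y + (- ?m) *\<^sub>R unit0"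
    by (simp add: x'_def y'_def algebra_simps)
  finally show ?thesis
    by (simp only: certainty_equivalent_shift)
qed

section \<open>The functional induced on payoff vectors\<close>

definition aggregator :: "real ^ 'n \<Rightarrow> real" where
  "aggregator u = certainty_equivalent (inv payoffs u)"

lemma payoffs_inv: "payoffs (inv payoffs u) = u"
  by (rule surj_f_inv_f[OF payoffs_surj])

text \<open>Streams with equal payoffs are indifferent by D-monotonicity, so the preimage chosen by
  \<open>inv\<close> does not matter.\<close>

lemma aggregator_payoffs: "aggregator (payoffs x) = certainty_equivalent x"
proof (rule antisym)
  have "R x (inv payoffs (payoffs x))" "R (inv payoffs (payoffs x)) x"
    by (auto intro!: R_mono simp: payoffs_inv simp del: payoffs_nth)
  then show "aggregator (payoffs x) \<le> certainty_equivalent x"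
    "certainty_equivalent x \<le> aggregator (payoffs x)"
    by (simp_all add: aggregator_def R_iff)
qed

lemma R_aggregator: "R x y \<longleftrightarrow> aggregator (payoffs y) \<le> aggregator (payoffs x)"
  by (simp add: aggregator_payoffs R_iff)

sublocale monetary_functional aggregator
proof
  show "aggregator 0 = 0"
    using aggregator_payoffs[of "0 *\<^sub>R unit0"] certainty_equivalent_const[of 0] by (simp add: payoffs_linear)
next
  fix u v :: "real ^ 'n" assume "\<And>i. v $ i \<le> u $ i"
  then have "R (inv payoffs u) (inv payoffs v)"
    by (intro R_mono) (simp add: payoffs_inv del: payoffs_nth)
  then show "aggregator v \<le> aggregator u"
    by (simp add: R_aggregator payoffs_inv)
next
  fix u :: "real ^ 'n" and k :: real
  show "aggregator (u + k *\<^sub>R 1) = aggregator u + k"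
    using aggregator_payoffs[of "inv payoffs u + k *\<^sub>R unit0"]
    by (simp add: payoffs_linear payoffs_inv payoffs_unit0 certainty_equivalent_shift aggregator_def)
next
  fix u v :: "real ^ 'n" and \<alpha> :: real
  assume \<alpha>: "0 \<le> \<alpha>" "\<alpha> \<le> 1"
  have "aggregator (\<alpha> *\<^sub>R u + (1 - \<alpha>) *\<^sub>R v)
      = certainty_equivalent (\<alpha> *\<^sub>R inv payoffs u + (1 - \<alpha>) *\<^sub>R inv payoffs v)"
    by (simp add: aggregator_payoffs[symmetric] payoffs_linear payoffs_inv)
  then show "\<alpha> * aggregator u + (1 - \<alpha>) * aggregator v \<le> aggregator (\<alpha> *\<^sub>R u + (1 - \<alpha>) *\<^sub>R v)"
    using certainty_equivalent_concave[OF \<alpha>] by (simp add: aggregator_def)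
qed

lemma nondegenerate_cost: "nondegenerate conj_cost"
proof -
  obtain x y \<alpha> where xy: "indiff_part R x y" and \<alpha>: "\<alpha> \<in> {0<..<1}"
    and strict: "strict_part R (\<alpha> *\<^sub>R x + (1 - \<alpha>) *\<^sub>R y) x"
    using conv_b by (auto simp: pref_convexity_b_def)
  define k where "k = aggregator (payoffs x)"
  have y: "aggregator (payoffs y) = k"
    using xy by (simp add: indiff_part_def R_aggregator k_def)
  have "k < aggregator (\<alpha> *\<^sub>R payoffs x + (1 - \<alpha>) *\<^sub>R payoffs y)"
    using strict by (simp add: strict_part_def R_aggregator k_def payoffs_linear)
  \<comment> \<open>Subtracting the common value \<open>k\<close> brings both vectors to level 0, as
    \<open>nondegenerate_conj_cost\<close> demands.\<close>
  also have "\<alpha> *\<^sub>R payoffs x + (1 - \<alpha>) *\<^sub>R payoffs y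
      = \<alpha> *\<^sub>R (payoffs x + (- k) *\<^sub>R 1) + (1 - \<alpha>) *\<^sub>R (payoffs y + (- k) *\<^sub>R 1) + k *\<^sub>R 1"
    by (simp add: algebra_simps)
  finally have "0 < aggregator (\<alpha> *\<^sub>R (payoffs x + (- k) *\<^sub>R 1) + (1 - \<alpha>) *\<^sub>R (payoffs y + (- k) *\<^sub>R 1))"
    unfolding trans by simp
  moreover have "aggregator (payoffs x + (- k) *\<^sub>R 1) = 0" "aggregator (payoffs y + (- k) *\<^sub>R 1) = 0"
    unfolding trans using y by (simp_all add: k_def)
  ultimately show ?thesis
    using nondegenerate_conj_cost \<alpha> by blast
qed

lemma representation: "variational_representation d conj_cost R"
  unfolding variational_representation_def
proof (intro conjI allI)
  fix x
  obtain \<mu> where "\<mu> \<in> prob_simplex"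
    "ereal (payoffs x \<bullet> \<mu>) + enn2ereal (conj_cost \<mu>) = ereal (aggregator (payoffs x))"
    using penalty_attained by blast
  then show "\<exists>\<mu>. is_arg_min (penalized d conj_cost x) (\<lambda>\<mu>. \<mu> \<in> prob_simplex) \<mu>"
    unfolding is_arg_min_def penalized_payoffs by (metis penalty_ge not_le)
qed (simp add: penalized_payoffs INF_penalty R_aggregator)

end

section \<open>From the representation to the axioms\<close>

locale variational_preference = discount_factors d for d :: "'n::finite \<Rightarrow> real" +
  fixes R :: preference and c :: "real ^ 'n \<Rightarrow> ennreal"
  assumes nondeg: "nondegenerate c"
    and representation: "variational_representation d c R"
begin

definition value_at :: "real ^ 'n \<Rightarrow> ereal" where
  "value_at u = (INF \<mu>\<in>prob_simplex. ereal (u \<bullet> \<mu>) + enn2ereal (c \<mu>))"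

text \<open>\<open>real_of_ereal\<close> sends infinite values to 0, but \<open>value_eq\<close>
  shows that none occur.\<close>

definition utility :: "real ^ 'n \<Rightarrow> real" where
  "utility u = real_of_ereal (value_at u)"

lemma value_le: "\<mu> \<in> prob_simplex \<Longrightarrow> value_at u \<le> ereal (u \<bullet> \<mu>) + enn2ereal (c \<mu>)"
  unfolding value_at_def by (rule INF_lower)

text \<open>Surjectivity of \<open>payoffs\<close> transfers attainment from streams to all vectors;
  a point of finite cost, supplied by nondegeneracy, makes the minimum finite.\<close>

lemma value_attained:
  obtains \<mu> where "\<mu> \<in> prob_simplex" "c \<mu> < \<infinity>" "value_at u = ereal (u \<bullet> \<mu> + enn2real (c \<mu>))"
proof -
  obtain x where x: "u = payoffs x"
    using payoffs_surj by blast
  obtain \<mu> where "is_arg_min (penalized d c x) (\<lambda>\<mu>. \<mu> \<in> prob_simplex) \<mu>"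
    using representation unfolding variational_representation_def by blast
  then have \<mu>: "\<mu> \<in> prob_simplex"
    "\<And>\<nu>. \<nu> \<in> prob_simplex \<Longrightarrow> ereal (u \<bullet> \<mu>) + enn2ereal (c \<mu>) \<le> ereal (u \<bullet> \<nu>) + enn2ereal (c \<nu>)"
    by (auto simp: is_arg_min_def penalized_payoffs x not_less)
  obtain \<nu> where \<nu>: "\<nu> \<in> prob_simplex" "c \<nu> < \<infinity>"
    using nondeg by (auto simp: nondegenerate_def)
  have "ereal (u \<bullet> \<mu>) + enn2ereal (c \<mu>) \<le> ereal (u \<bullet> \<nu> + enn2real (c \<nu>))"
    using \<mu>(2)[OF \<nu>(1)] penalty_finite[where c = c, OF \<nu>(2)] by simp
  then have "enn2ereal (c \<mu>) \<noteq> \<infinity>"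
    by auto
  then have fin: "c \<mu> < \<infinity>"
    by (simp add: less_top)
  have "value_at u = ereal (u \<bullet> \<mu>) + enn2ereal (c \<mu>)"
    by (rule antisym[OF value_le[OF \<mu>(1)]]) (auto simp: value_at_def intro!: INF_greatest \<mu>(2))
  then show ?thesis
    using that \<mu>(1) fin penalty_finite[where c = c, OF fin] by simp
qed

lemma value_eq: "value_at u = ereal (utility u)"
  by (rule value_attained[of u]) (simp add: utility_def)

lemma utility_attained:
  obtains \<mu> where "\<mu> \<in> prob_simplex" "c \<mu> < \<infinity>" "utility u = u \<bullet> \<mu> + enn2real (c \<mu>)"
  by (rule value_attained[of u]) (simp add: utility_def)

lemma utility_le:
  assumes "\<mu> \<in> prob_simplex" "c \<mu> < \<infinity>"
  shows "utility u \<le> u \<bullet> \<mu> + enn2real (c \<mu>)"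
  using value_le[OF assms(1), of u] penalty_finite[where c = c, OF assms(2)] by (simp add: value_eq)

lemma R_iff: "R x y \<longleftrightarrow> utility (payoffs y) \<le> utility (payoffs x)"
  using representation
  by (simp add: variational_representation_def penalized_payoffs value_at_def[symmetric] value_eq)

text \<open>Here and in the next three lemmas, a minimizer for one vector serves as a test point for
  another.\<close>

lemma utility_mono:
  assumes "\<And>i. v $ i \<le> u $ i"
  shows "utility v \<le> utility u"
proof -
  obtain \<mu> where \<mu>: "\<mu> \<in> prob_simplex" "c \<mu> < \<infinity>" "utility u = u \<bullet> \<mu> + enn2real (c \<mu>)"
    by (rule utility_attained)
  show ?thesis
    using utility_le[OF \<mu>(1,2), of v] inner_simplex_mono[OF \<mu>(1) assms] \<mu>(3) by simp
qed

lemma utility_shift: "utility (u + k *\<^sub>R 1) = utility u + k"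
proof -
  have le: "utility (u + k *\<^sub>R 1) \<le> utility u + k" for u k
  proof -
    obtain \<mu> where \<mu>: "\<mu> \<in> prob_simplex" "c \<mu> < \<infinity>" "utility u = u \<bullet> \<mu> + enn2real (c \<mu>)"
      by (rule utility_attained)
    show ?thesis
      using utility_le[OF \<mu>(1,2), of "u + k *\<^sub>R 1"] \<mu>(3)
      by (simp add: inner_add_left one_inner_simplex[OF \<mu>(1)])
  qed
  show ?thesis
    \<comment> \<open>The second instance shifts back by \<open>- k\<close> and gives the reverse
      inequality.\<close>
    using le[of u k] le[of "u + k *\<^sub>R 1" "- k"] by simp
qed

lemma utility_concave:
  assumes "0 \<le> \<alpha>" "\<alpha> \<le> 1"
  shows "\<alpha> * utility u + (1 - \<alpha>) * utility v \<le> utility (\<alpha> *\<^sub>R u + (1 - \<alpha>) *\<^sub>R v)"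
proof -
  obtain \<mu> where \<mu>: "\<mu> \<in> prob_simplex" "c \<mu> < \<infinity>"
    "utility (\<alpha> *\<^sub>R u + (1 - \<alpha>) *\<^sub>R v) = (\<alpha> *\<^sub>R u + (1 - \<alpha>) *\<^sub>R v) \<bullet> \<mu> + enn2real (c \<mu>)"
    by (rule utility_attained)
  have "\<alpha> * utility u + (1 - \<alpha>) * utility v
      \<le> \<alpha> * (u \<bullet> \<mu> + enn2real (c \<mu>)) + (1 - \<alpha>) * (v \<bullet> \<mu> + enn2real (c \<mu>))"
    using assms utility_le[OF \<mu>(1,2)] by (intro add_mono mult_left_mono) auto
  also have "\<dots> = utility (\<alpha> *\<^sub>R u + (1 - \<alpha>) *\<^sub>R v)"
    unfolding \<mu>(3) by (simp add: inner_add_left algebra_simps)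
  finally show ?thesis .
qed

text \<open>Points of the simplex have Euclidean norm at most 1, whence the constant. Continuity of
  the preference follows because \<open>payoffs\<close> is bounded linear.\<close>

lemma utility_lipschitz: "1-lipschitz_on UNIV utility"
proof -
  have le: "utility u - utility v \<le> norm (u - v)" for u v
  proof -
    obtain \<mu> where \<mu>: "\<mu> \<in> prob_simplex" "c \<mu> < \<infinity>" "utility v = v \<bullet> \<mu> + enn2real (c \<mu>)"
      by (rule utility_attained)
    have "utility u - utility v \<le> (u - v) \<bullet> \<mu>"
      using utility_le[OF \<mu>(1,2), of u] \<mu>(3) by (simp add: inner_diff_left)
    also have "\<dots> \<le> norm (u - v) * norm \<mu>"
      by (rule norm_cauchy_schwarz)
    also have "\<dots> \<le> norm (u - v)"
      using norm_simplex_le[OF \<mu>(1)] by (simp add: mult_left_le)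
    finally show ?thesis .
  qed
  show ?thesis
    by (rule lipschitz_onI) (use le in \<open>simp_all add: dist_norm abs_le_iff, metis norm_minus_commute\<close>)
qed

lemma continuous_utility: "continuous_on UNIV (\<lambda>x. utility (payoffs x))"
  using lipschitz_on_continuous_on[OF utility_lipschitz]
    linear_continuous_on[OF bounded_linear_payoffs, of UNIV]
  by (rule continuous_on_compose2) simp

lemma continuity: "pref_continuity R"
  unfolding pref_continuity_def R_iff
  by (intro allI conjI closed_Collect_le continuous_on_const continuous_utility)

lemma D_monotonicity: "D_monotonicity_a (range d) R"
  unfolding D_monotonicity_a_def R_iff by (auto intro: utility_mono)

lemma origin0: "origin0_invariance R"
  unfolding origin0_invariance_def R_iff
  by (auto elim!: linf0E simp: payoffs_linear payoffs_unit0 utility_shift)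

lemma convexity_a: "pref_convexity_a R"
  unfolding pref_convexity_a_def
proof (intro allI impI ballI)
  fix x y and \<alpha> :: real
  assume "indiff_part R x y" and \<alpha>: "\<alpha> \<in> {0..1}"
  then have "utility (payoffs y) = utility (payoffs x)"
    by (simp add: indiff_part_def R_iff)
  then show "R (\<alpha> *\<^sub>R x + (1 - \<alpha>) *\<^sub>R y) x"
    using utility_concave[of \<alpha> "payoffs x" "payoffs y"] \<alpha>
    by (simp add: R_iff payoffs_linear algebra_simps)
qed

text \<open>With \<open>\<mu>\<close> and \<open>\<nu>\<close> of finite cost and \<open>u = \<nu> - \<mu>\<close>, the sum of the utilities of \<open>t u\<close> and
  \<open>- t u\<close> is at most \<open>c \<mu> + c \<nu> - t |u|^2\<close>, which is negative for large \<open>t\<close>. Shifting both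
  vectors to utility \<open>0\<close> turns the negated half sum into the utility of their midpoint.\<close>

lemma convexity_b: "pref_convexity_b R"
proof -
  obtain \<mu> \<nu> where \<mu>: "\<mu> \<in> prob_simplex" "c \<mu> < \<infinity>" and \<nu>: "\<nu> \<in> prob_simplex" "c \<nu> < \<infinity>"
    and "\<mu> \<noteq> \<nu>"
    using nondeg by (auto simp: nondegenerate_def)
  define u where "u = \<nu> - \<mu>"
  have "u \<bullet> u > 0"
    using \<open>\<mu> \<noteq> \<nu>\<close> by (simp add: u_def)
  then obtain n where n: "enn2real (c \<mu>) + enn2real (c \<nu>) < real n * (u \<bullet> u)"
    using reals_Archimedean3 by blast
  define t where "t = real n"
  define v where "v = t *\<^sub>R u + (- utility (t *\<^sub>R u)) *\<^sub>R 1"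
  define w where "w = (- t) *\<^sub>R u + (- utility ((- t) *\<^sub>R u)) *\<^sub>R 1"
  have 0: "utility v = 0" "utility w = 0"
    by (simp_all only: v_def w_def utility_shift)
  have "utility (t *\<^sub>R u) + utility ((- t) *\<^sub>R u)
      \<le> (t *\<^sub>R u \<bullet> \<mu> + enn2real (c \<mu>)) + ((- t) *\<^sub>R u \<bullet> \<nu> + enn2real (c \<nu>))"
    by (intro add_mono utility_le \<mu> \<nu>)
  also have "\<dots> = enn2real (c \<mu>) + enn2real (c \<nu>) - t * (u \<bullet> u)"
    by (simp add: u_def inner_diff_left inner_diff_right algebra_simps)
  finally have neg: "utility (t *\<^sub>R u) + utility ((- t) *\<^sub>R u) < 0"
    using n by (simp add: t_def)
  \<comment> \<open>At 0 only the cost remains, and it is nonnegative.\<close>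
  have nonneg: "0 \<le> utility 0"
    by (rule utility_attained[of 0]) simp
  \<comment> \<open>The multiples of \<open>u\<close> cancel, leaving a constant vector; the summand
    0 gives it the form that \<open>utility_shift\<close> rewrites.\<close>
  have mid: "(1/2) *\<^sub>R v + (1 - 1/2) *\<^sub>R w
      = 0 + (- (utility (t *\<^sub>R u) + utility ((- t) *\<^sub>R u)) / 2) *\<^sub>R 1"
    by (simp add: v_def w_def vec_eq_iff field_simps)
  have pos: "utility ((1/2) *\<^sub>R v + (1 - 1/2) *\<^sub>R w) > 0"
    unfolding mid utility_shift using nonneg neg by (simp add: field_simps)
  obtain x y where xy: "payoffs x = v" "payoffs y = w"
    using payoffs_surj by (metis surjD)
  have "indiff_part R x y" "strict_part R ((1/2) *\<^sub>R x + (1 - 1/2) *\<^sub>R y) x"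
    using pos by (simp_all add: indiff_part_def strict_part_def R_iff payoffs_linear xy 0)
  then show ?thesis
    unfolding pref_convexity_b_def
    by (intro exI[of _ x] exI[of _ y] conjI bexI[of _ "1/2"]) auto
qed

end

theorem theorem3p2:
  fixes d :: "'n::finite \<Rightarrow> real" and D :: "real set" and R :: preference
  assumes "inj d" and "D = range d" and "D \<subseteq> {0<..<1}"
    and "weak_order R"
  shows "(D_monotonicity_a D R \<and> pref_continuity R \<and> pref_convexity_a R \<and> pref_convexity_b R
            \<and> origin0_invariance R) \<longleftrightarrow>
         (\<exists>c :: real ^ 'n \<Rightarrow> ennreal.
            grounded c \<and> convex_cost c \<and> lsc_cost c \<and> nondegenerate c
            \<and> variational_representation d c R)"
proof
  assume "D_monotonicity_a D R \<and> pref_continuity R \<and> pref_convexity_a R \<and> pref_convexity_b R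
            \<and> origin0_invariance R"
  then interpret rational_preference d R
    using assms by unfold_locales auto
  show "\<exists>c :: real ^ 'n \<Rightarrow> ennreal. grounded c \<and> convex_cost c \<and> lsc_cost c \<and> nondegenerate c
            \<and> variational_representation d c R"
    using grounded_conj_cost convex_conj_cost lsc_conj_cost nondegenerate_cost representation
    by blast
next
  assume "\<exists>c :: real ^ 'n \<Rightarrow> ennreal. grounded c \<and> convex_cost c \<and> lsc_cost c \<and> nondegenerate c
            \<and> variational_representation d c R"
  then obtain c :: "real ^ 'n \<Rightarrow> ennreal" where "nondegenerate c" "variational_representation d c R"
    by blast
  then interpret variational_preference d R c
    using assms by unfold_locales auto
  show "D_monotonicity_a D R \<and> pref_continuity R \<and> pref_convexity_a R \<and> pref_convexity_b R
            \<and> origin0_invariance R"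
    using D_monotonicity continuity convexity_a convexity_b origin0 assms(2) by simp
qed

end
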